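(* Let $n=2m$ be an even positive integer and let $A$ be an $n\times n$ skew-symmetric matrix with copfaffian matrix $\widehat A$. Then for any $I\subseteq[n]$ with $\sharp I=2r$, $$\operatorname{Pf}\bigl[(\widehat A)^I_I\bigr]=(-1)^{|I|-r}\,[\operatorname{Pf}(A)]^{r-1}\,\operatorname{Pf}\bigl(A^{\overline I}_{\overline I}\bigr).$$ In particular, $\widehat{\widehat A}=(\operatorname{Pf}A)^{m-2}A$.
   Context: Matrix entries lie in a commutative ring. $[n]=\{1,\dots,n\}$. $\operatorname{Pf}$ denotes the Pfaffian of a skew-symmetric matrix of even size, normalized by $\operatorname{Pf}\begin{pmatrix}0&a\\-a&0\end{pmatrix}=a$, i.e. $\operatorname{Pf}(A)=\sum \epsilon(\sigma)\,a_{\sigma_1\sigma_2}\cdots a_{\sigma_{n-1}\sigma_n}$ over all partitions $\{\{\sigma_1<\sigma_2\},\dots,\{\sigma_{n-1}<\sigma_n\}\}$ of $[n]$ into 2-element blocks, where $\epsilon(\sigma)$ is the sign of the permutation $i\mapsto\sigma_i$; the Pfaffian of the empty matrix is $1$. For $I\subseteq[n]$, $A^I_I$ is the submatrix of $A$ with rows and columns indexed by $I$ (in increasing order), $\overline I=[n]\setminus I$, and $|I|=\sum_{i\in I}i$. For a skew-symmetric matrix $A$ of even size $n$, the copfaffian matrix $\widehat A$ is the skew-symmetric matrix whose $(i,j)$ entry, for $1\le i<j\le n$, is $\gamma(i,j)=(-1)^{i+j-1}\operatorname{Pf}\bigl(A^{\overline{\{i,j\}}}_{\overline{\{i,j\}}}\bigr)$.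 In the degenerate cases $r=0$ or $m=1$, where a negative power of $\operatorname{Pf}(A)$ occurs, $\operatorname{Pf}(A)$ is understood to be invertible. *)

theory Defs
  imports
    "HOL-Library.Disjoint_Sets"
    "HOL-Combinatorics.Permutations"
    "Jordan_Normal_Form.Matrix"
    "Jordan_Normal_Form.DL_Submatrix"
begin

(* Matrices, rows, columns and permutations are indexed from 0: index i stands for i + 1 in
   [n] = {1, ..., n}.  Wherever a sign depends on the values of indices, they are therefore
   shifted back by Suc. *)

(* Over a commutative ring in which 2 may be a zero divisor, skew-symmetry includes a vanishing
   diagonal. *)
definition skew_symmetric :: "'a::comm_ring_1 mat \<Rightarrow> bool" where
  "skew_symmetric A \<longleftrightarrow> square_mat A \<and> transpose_mat A = - A \<and> (\<forall>i<dim_row A. A $$ (i, i) = 0)"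

definition matchings :: "nat \<Rightarrow> nat set set set" where
  "matchings n = {M. partition_on {..<n} M \<and> (\<forall>B\<in>M. card B = 2)}"

(* \<sigma> writes M as {{\<sigma> 0 < \<sigma> 1}, {\<sigma> 2 < \<sigma> 3}, ...}, with the blocks in any order. *)
definition lists_matching :: "nat \<Rightarrow> (nat \<Rightarrow> nat) \<Rightarrow> nat set set \<Rightarrow> bool" where
  "lists_matching n \<sigma> M \<longleftrightarrow> \<sigma> permutes {..<n} \<and>
     (\<forall>k<n div 2. \<sigma> (2 * k) < \<sigma> (2 * k + 1)) \<and>
     M = (\<lambda>k. {\<sigma> (2 * k), \<sigma> (2 * k + 1)}) ` {..<n div 2}"

definition pf_term :: "'a::comm_ring_1 mat \<Rightarrow> (nat \<Rightarrow> nat) \<Rightarrow> 'a" where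
  "pf_term A \<sigma> =
     of_int (sign \<sigma>) * (\<Prod>k<dim_row A div 2. A $$ (\<sigma> (2 * k), \<sigma> (2 * k + 1)))"

(* By pf_term_unique and lists_matching_exists below, the choice of the listing is immaterial. *)
definition Pf :: "'a::comm_ring_1 mat \<Rightarrow> 'a" where
  "Pf A = (\<Sum>M\<in>matchings (dim_row A). pf_term A (SOME \<sigma>. lists_matching (dim_row A) \<sigma> M))"

definition copf_entry :: "'a::comm_ring_1 mat \<Rightarrow> nat \<Rightarrow> nat \<Rightarrow> 'a" where
  "copf_entry A i j =
     (- 1) ^ (Suc i + Suc j - 1) *
     Pf (submatrix A ({..<dim_row A} - {i, j}) ({..<dim_row A} - {i, j}))"

definition copf_mat :: "'a::comm_ring_1 mat \<Rightarrow> 'a mat" where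
  "copf_mat A = mat (dim_row A) (dim_row A)
     (\<lambda>(i, j). if i < j then copf_entry A i j else if j < i then - copf_entry A j i else 0)"

(* The library's power_int needs a division operation; here x is only required to be a unit
   when the exponent is negative. *)
definition unit_powi :: "'a::comm_ring_1 \<Rightarrow> int \<Rightarrow> 'a" where
  "unit_powi x k = (if 0 \<le> k then x ^ nat k else (THE y. x * y = 1) ^ nat (- k))"

lemma unit_inverse_eqI:
  fixes x y :: "'a::comm_ring_1"
  assumes "x * y = 1"
  shows "(THE z. x * z = 1) = y"
proof (rule the_equality)
  fix z assume "x * z = 1"
  then show "z = y"
    using assms by (metis mult.assoc mult.commute mult_1)
qed (fact assms)

definition pair_blocks :: "(nat \<Rightarrow> nat) \<Rightarrow> nat \<Rightarrow> nat" where
  "pair_blocks \<rho> i = 2 * \<rho> (i div 2) + i mod 2"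

lemma sign_pair_blocks:
  assumes "\<rho> permutes {..<h::nat}"
  shows "permutation (pair_blocks \<rho>) \<and> sign (pair_blocks \<rho>) = 1"
  using assms finite_lessThan[of h]
proof (induction \<rho> rule: permutes_induct)
  case id
  have "pair_blocks id = id"
    by (rule ext) (simp add: pair_blocks_def)
  then show ?case by (simp only: permutation_id sign_id simp_thms)
next
  case (swap a b p)
  have comp: "pair_blocks (transpose a b \<circ> p) = pair_blocks (transpose a b) \<circ> pair_blocks p"
    by (rule ext) (simp add: pair_blocks_def)
  have tr: "pair_blocks (transpose a b)
      = transpose (2 * a) (2 * b) \<circ> transpose (2 * a + 1) (2 * b + 1)"
  proof
    fix i :: nat
    define q where "q = i div 2"
    have q: "i = 2 * q \<or> i = 2 * q + 1" unfolding q_def by presburger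
    have odd_neq: "2 * x \<noteq> 2 * y + 1" "2 * y + 1 \<noteq> 2 * x" for x y :: nat
      by presburger+
    have ev: "pair_blocks \<rho>' (2 * q) = 2 * \<rho>' q" and od: "pair_blocks \<rho>' (2 * q + 1) = 2 * \<rho>' q + 1"
      for \<rho>' by (simp_all add: pair_blocks_def)
    show "pair_blocks (transpose a b) i
        = (transpose (2 * a) (2 * b) \<circ> transpose (2 * a + 1) (2 * b + 1)) i"
      using q
    proof
      assume "i = 2 * q"
      then show ?thesis unfolding comp_apply
        by (simp only: ev) (use odd_neq in \<open>simp add: transpose_def\<close>)
    next
      assume "i = 2 * q + 1"
      then show ?thesis unfolding comp_apply
        by (simp only: od) (use odd_neq in \<open>simp add: transpose_def\<close>)
    qed
  qed
  have "permutation (pair_blocks (transpose a b))"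
    unfolding tr by (intro permutation_compose permutation_swap_id)
  moreover have "sign (pair_blocks (transpose a b)) = 1"
    unfolding tr using \<open>a \<noteq> b\<close>
    by (subst sign_compose) (auto simp: permutation_swap_id sign_swap_id)
  ultimately show ?case
    using swap unfolding comp by (metis permutation_compose sign_compose mult_1)
qed

lemma pf_term_unique:
  assumes "even (dim_row A)"
    and \<sigma>: "lists_matching (dim_row A) \<sigma> M" and \<tau>: "lists_matching (dim_row A) \<tau> M"
  shows "pf_term A \<sigma> = pf_term A \<tau>"
proof -
  obtain h where h: "dim_row A = 2 * h" using assms(1) by auto
  have ps: "\<sigma> permutes {..<2 * h}" and pt: "\<tau> permutes {..<2 * h}"
    using \<sigma> \<tau> by (auto simp: lists_matching_def h)
  have "\<exists>l<h. \<tau> (2 * k) = \<sigma> (2 * l) \<and> \<tau> (2 * k + 1) = \<sigma> (2 * l + 1)" if "k < h" for k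
  proof -
    have "{\<tau> (2 * k), \<tau> (2 * k + 1)} \<in> M" using \<tau> that by (auto simp: lists_matching_def h)
    then obtain l where l: "l < h" "{\<tau> (2 * k), \<tau> (2 * k + 1)} = {\<sigma> (2 * l), \<sigma> (2 * l + 1)}"
      using \<sigma> by (auto simp: lists_matching_def h)
    moreover have "\<tau> (2 * k) < \<tau> (2 * k + 1)" "\<sigma> (2 * l) < \<sigma> (2 * l + 1)"
      using \<sigma> \<tau> that l(1) by (auto simp: lists_matching_def h)
    ultimately show ?thesis by (metis doubleton_eq_iff less_asym)
  qed
  then obtain f where f: "\<And>k. k < h \<Longrightarrow> f k < h"
      "\<And>k. k < h \<Longrightarrow> \<tau> (2 * k) = \<sigma> (2 * f k)" "\<And>k. k < h \<Longrightarrow> \<tau> (2 * k + 1) = \<sigma> (2 * f k + 1)"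
    by metis
  define \<rho> where "\<rho> k = (if k < h then f k else k)" for k
  have "inj_on f {..<h}"
  proof (rule inj_onI)
    fix k l assume "k \<in> {..<h}" "l \<in> {..<h}" "f k = f l"
    then have "\<tau> (2 * k) = \<tau> (2 * l)" using f(2) by simp
    then show "k = l" by (simp add: inj_eq[OF permutes_inj[OF pt]])
  qed
  then have "bij_betw f {..<h} {..<h}"
    using f(1) by (intro bij_betw_imageI endo_inj_surj) auto
  then have "bij_betw \<rho> {..<h} {..<h}"
    by (rule bij_betw_cong[THEN iffD1, rotated]) (simp add: \<rho>_def)
  then have pr: "\<rho> permutes {..<h}"
    by (rule bij_imp_permutes) (simp add: \<rho>_def)
  have "\<tau> = \<sigma> \<circ> pair_blocks \<rho>"
  proof
    fix i
    show "\<tau> i = (\<sigma> \<circ> pair_blocks \<rho>) i"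
    proof (cases "i < 2 * h")
      case True
      define k where "k = i div 2"
      have "k < h" "i = 2 * k \<or> i = 2 * k + 1" using True unfolding k_def by presburger+
      then show ?thesis using f by (auto simp: pair_blocks_def \<rho>_def)
    next
      case False
      then have "pair_blocks \<rho> i = i" by (auto simp: pair_blocks_def \<rho>_def)
      then show ?thesis using False ps pt by (simp add: permutes_not_in)
    qed
  qed
  then have "sign \<tau> = sign \<sigma>"
    using sign_pair_blocks[OF pr] permutation_permutes ps finite_lessThan
    by (metis mult.right_neutral sign_compose)
  moreover have "(\<Prod>k<h. A $$ (\<tau> (2 * k), \<tau> (2 * k + 1)))
      = (\<Prod>k<h. A $$ (\<sigma> (2 * \<rho> k), \<sigma> (2 * \<rho> k + 1)))"
    by (rule prod.cong) (use f(2,3) in \<open>auto simp: \<rho>_def\<close>)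
  moreover have "\<dots> = (\<Prod>k<h. A $$ (\<sigma> (2 * k), \<sigma> (2 * k + 1)))"
    by (rule prod.reindex_bij_betw) (rule permutes_imp_bij[OF pr])
  ultimately show ?thesis by (simp add: pf_term_def h)
qed

lemma lists_matching_exists:
  assumes "M \<in> matchings n"
  shows "\<exists>\<sigma>. lists_matching n \<sigma> M"
proof -
  have part: "partition_on {..<n} M" and c2: "\<And>B. B \<in> M \<Longrightarrow> card B = 2"
    using assms by (auto simp: matchings_def)
  have fin: "finite M" using part finite_elements[OF finite_lessThan] by blast
  have U: "\<Union>M = {..<n}" and dj: "disjoint M" using part by (auto simp: partition_on_def)
  have "card (\<Union>M) = sum card M"
    using dj c2 by (intro card_Union_disjoint) (auto simp: card_ge_0_finite disjoint_def pairwise_def disjnt_def)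
  then have n: "n = 2 * card M" using c2 by (simp add: U)
  define h where "h = card M"
  obtain e where e: "bij_betw e {..<h} M"
    using ex_bij_betw_nat_finite[OF fin] by (auto simp: h_def atLeast0LessThan)
  have "\<exists>a b. a < b \<and> B = {a, b}" if "B \<in> M" for B
    using c2[OF that] by (metis card_2_iff insert_commute linorder_neqE_nat)
  then obtain lo hi where lh: "\<And>B. B \<in> M \<Longrightarrow> lo B < hi B \<and> B = {lo B, hi B :: nat}"
    by metis
  define \<sigma> where "\<sigma> i = (if i < n then (if even i then lo else hi) (e (i div 2)) else i)" for i
  have eM: "e k \<in> M" if "k < h" for k using e that by (auto simp: bij_betw_def)
  have s0: "\<sigma> (2 * k) = lo (e k)" and s1: "\<sigma> (2 * k + 1) = hi (e k)" if "k < h" for k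
    using that n by (simp_all add: \<sigma>_def h_def)
  have img: "M = (\<lambda>k. {\<sigma> (2 * k), \<sigma> (2 * k + 1)}) ` {..<h}"
  proof -
    have "M = e ` {..<h}" using e by (simp add: bij_betw_def)
    also have "\<dots> = (\<lambda>k. {\<sigma> (2 * k), \<sigma> (2 * k + 1)}) ` {..<h}"
      by (rule image_cong) (use s0 s1 lh eM in auto)
    finally show ?thesis .
  qed
  have surj: "\<sigma> ` {..<n} = {..<n}"
  proof
    show "{..<n} \<subseteq> \<sigma> ` {..<n}"
    proof
      fix x assume "x \<in> {..<n}"
      then obtain k where "k < h" "x = \<sigma> (2 * k) \<or> x = \<sigma> (2 * k + 1)"
        using U img by auto
      then show "x \<in> \<sigma> ` {..<n}" using n by (auto simp: h_def)
    qed
    show "\<sigma> ` {..<n} \<subseteq> {..<n}"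
    proof
      fix x assume "x \<in> \<sigma> ` {..<n}"
      then obtain i where i: "i < n" "x = \<sigma> i" by auto
      then have "e (i div 2) \<in> M" using n by (intro eM) (auto simp: h_def)
      moreover have "x \<in> e (i div 2)" using lh[OF calculation] i by (auto simp: \<sigma>_def)
      ultimately show "x \<in> {..<n}" using U by blast
    qed
  qed
  then have "bij_betw \<sigma> {..<n} {..<n}"
    by (simp add: bij_betw_def eq_card_imp_inj_on)
  then have "\<sigma> permutes {..<n}" by (rule bij_imp_permutes) (simp add: \<sigma>_def)
  moreover have "\<forall>k<h. \<sigma> (2 * k) < \<sigma> (2 * k + 1)" using s0 s1 lh eM by simp
  moreover have "n div 2 = h" using n by (simp add: h_def)
  ultimately show ?thesis using img unfolding lists_matching_def by blast
qed

end

theory Submission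
  imports Defs "Jordan_Normal_Form.Determinant"
begin

text \<open>
  Expansion along the first letter presents the Pfaffian of a word of indices as an iterated
  contraction, the contraction along \<open>f\<close> being the signed sum over all ways of deleting a letter
  \<open>x\<close>, weighted by \<open>f x\<close>.  Contractions anticommute, so the Pfaffian alternates in the letters.
  For two words \<open>a\<close>, \<open>b\<close> of odd length, expand both sums
  \<open>\<Sum>\<plusminus> Pf (a - x) Pf (x b)\<close> and \<open>\<Sum>\<plusminus> Pf (b - y) Pf (y a)\<close> along the moved letter: up to
  sign they become the same double sum over the pairs \<open>(x, y)\<close>, which is the Pfaffian Pluecker
  relation.  With \<open>a = [n] - i\<close> and \<open>b = ([n] - I) \<union> {i}\<close>, where \<open>i = min I\<close>, it is precisely
  the induction step on \<open>r\<close> after the copfaffian minor on \<open>I\<close> has been expanded along row \<open>i\<close>.  No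
  division occurs for \<open>r \<ge> 1\<close>, so no generic matrix is needed.
\<close>

section \<open>Contractions of functions on words\<close>

text \<open>The letters passed over are pushed into the argument of \<open>G\<close>, hence the
  inductions with \<open>G\<close> arbitrary; the minus sign shifts all later positions by
  one.\<close>

primrec contract :: "('b \<Rightarrow> 'a::comm_ring_1) \<Rightarrow> ('b list \<Rightarrow> 'a) \<Rightarrow> 'b list \<Rightarrow> 'a" where
  "contract f G [] = 0"
| "contract f G (x # w) = f x * G w - contract f (\<lambda>u. G (x # u)) w"

lemma contract_uminus: "contract f (\<lambda>u. - G u) w = - contract f G w"
  by (induction w arbitrary: G) (auto simp: algebra_simps)

lemma contract_diff: "contract f (\<lambda>u. G u - H u) w = contract f G w - contract f H w"
  by (induction w arbitrary: G H) (auto simp: algebra_simps)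

lemma contract_mult: "contract f (\<lambda>u. c * G u) w = c * contract f G w"
  by (induction w arbitrary: G) (auto simp: algebra_simps)

lemma contract_zero: "contract f (\<lambda>u. 0) w = 0"
  by (induction w) auto

lemma contract_zero_fun: "contract (\<lambda>x. 0) G w = 0"
  by (induction w arbitrary: G) auto

lemma contract_uminus_fun: "contract (\<lambda>x. - f x) G w = - contract f G w"
  by (induction w arbitrary: G) auto

lemma contract_diff_mult_fun:
  "contract (\<lambda>x. f x * c - g x) G w = contract f G w * c - contract g G w"
  by (induction w arbitrary: G) (auto simp: algebra_simps)

text \<open>Peeling off \<open>x\<close> leaves \<open>f x * contract f G w\<close> twice with
  opposite signs and a shorter double contraction. Anticommutation alone would only show that twice
  the value is 0.\<close>

lemma contract_contract_same: "contract f (contract f G) w = 0"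
proof (induction w arbitrary: G)
  case (Cons x w)
  show ?case by (simp add: contract_diff contract_mult Cons)
qed simp

text \<open>Deleting two letters in either order gives the same word, but the later letter moves
  down one position once the earlier one is gone.\<close>

lemma contract_anticommute: "contract f (contract g G) w = - contract g (contract f G) w"
proof (induction w arbitrary: G)
  case (Cons x w)
  show ?case by (simp add: contract_diff contract_mult Cons[of "\<lambda>u. G (x # u)"])
qed simp

text \<open>Both sides are the signed double sum over letters \<open>x\<close> of \<open>a\<close>
  and \<open>z\<close> of \<open>b\<close> of \<open>A x z\<close> times \<open>F\<close> and
  \<open>G\<close> at the shortened words. The deletions act on different words, so no sign
  arises.\<close>

lemma contract_interchange:
  "contract (\<lambda>y. contract (A y) G b) F a = contract (\<lambda>z. contract (\<lambda>y. A y z) F a) G b"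
proof (induction a arbitrary: F)
  case Nil
  show ?case by (simp add: contract_zero_fun)
next
  case (Cons x a)
  show ?case by (simp add: Cons contract_diff_mult_fun)
qed

lemma contract_nth:
  "contract f G w = (\<Sum>k<length w. (- 1) ^ k * f (w ! k) * G (take k w @ drop (Suc k) w))"
proof (induction w arbitrary: G)
  case (Cons x w)
  show ?case
    by (simp add: Cons sum.lessThan_Suc_shift sum_negf del: sum.lessThan_Suc)
qed simp

text \<open>Vanishing on equal neighbours is a separate clause, since the swap rule alone only makes
  twice the value 0.\<close>

definition alternating :: "('b list \<Rightarrow> 'a::comm_ring_1) \<Rightarrow> bool" where
  "alternating G \<longleftrightarrow> (\<forall>u x y v. G (u @ x # y # v) = - G (u @ y # x # v)) \<and>
     (\<forall>u x v. G (u @ x # x # v) = 0)"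

lemma alternating_swap: "alternating G \<Longrightarrow> G (u @ x # y # v) = - G (u @ y # x # v)"
  and alternating_same: "alternating G \<Longrightarrow> G (u @ x # x # v) = 0"
  unfolding alternating_def by blast+

lemma alternating_Cons:
  assumes "alternating G"
  shows "alternating (\<lambda>u. G (x # u))"
  using alternating_swap[OF assms, of "x # _"] alternating_same[OF assms, of "x # _"]
  unfolding alternating_def append_Cons by blast

text \<open>Deleting a letter other than the two neighbours keeps them adjacent; the two terms
  deleting one of them are exchanged, with positions differing by one.\<close>

lemma alternating_contract:
  assumes "alternating G"
  shows "alternating (contract f G)"
proof -
  have "contract f G (u @ x # y # v) = - contract f G (u @ y # x # v)" for u x y v
    using assms
  proof (induction u arbitrary: G)
    case Nil
    have "(\<lambda>w. G (x # y # w)) = (\<lambda>w. - G (y # x # w))"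
      using alternating_swap[OF Nil, of "[]" x y] by auto
    then show ?case by (simp add: contract_uminus)
  next
    case (Cons z u)
    show ?case
      using Cons.IH[OF alternating_Cons[OF Cons.prems], of z]
        alternating_swap[OF Cons.prems, of u x y v] by simp
  qed
  moreover have "contract f G (u @ x # x # v) = 0" for u x v
    using assms
  proof (induction u arbitrary: G)
    case Nil
    have "(\<lambda>w. G (x # x # w)) = (\<lambda>w. 0)"
      using alternating_same[OF Nil, of "[]"] by auto
    then show ?case by (simp add: contract_zero)
  next
    case (Cons z u)
    show ?case
      using Cons.IH[OF alternating_Cons[OF Cons.prems], of z]
        alternating_same[OF Cons.prems, of u x v] by simp
  qed
  ultimately show ?thesis unfolding alternating_def by blast
qed

lemma alternating_move:
  assumes "alternating G"
  shows "G (y # u @ v) = (- 1) ^ length u * G (u @ y # v)"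
  using assms
proof (induction u arbitrary: G)
  case (Cons z u)
  show ?case
    using Cons.IH[OF alternating_Cons[OF Cons.prems], of z]
      alternating_swap[OF Cons.prems, of "[]" y z] by simp
qed simp

lemma alternating_repeat:
  assumes "alternating G" "y \<in> set w"
  shows "G (y # w) = 0"
proof -
  obtain u v where "w = u @ y # v" using assms(2) by (meson split_list)
  then show ?thesis
    using alternating_move[OF assms(1), of y u "y # v"] alternating_same[OF assms(1)] by simp
qed

section \<open>Pfaffians of words and their Pluecker relation\<close>

text \<open>\<open>pf_word K m w\<close> is the Pfaffian of the matrix with entries \<open>K (w ! a) (w ! b)\<close>, provided that
  \<open>w\<close> has length \<open>2 * m\<close>; the index \<open>m\<close> only makes the recursion structural.\<close>

fun pf_word :: "('b \<Rightarrow> 'b \<Rightarrow> 'a::comm_ring_1) \<Rightarrow> nat \<Rightarrow> 'b list \<Rightarrow> 'a" where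
  "pf_word A 0 w = (if w = [] then 1 else 0)"
| "pf_word A (Suc m) [] = 0"
| "pf_word A (Suc m) (x # w) = contract (A x) (pf_word A m) w"

definition alternating_form :: "('b \<Rightarrow> 'b \<Rightarrow> 'a::comm_ring_1) \<Rightarrow> bool" where
  "alternating_form A \<longleftrightarrow> (\<forall>x y. A x y = - A y x) \<and> (\<forall>x. A x x = 0)"

lemma alternating_form_swap: "alternating_form A \<Longrightarrow> A x y = - A y x"
  and alternating_form_same: "alternating_form A \<Longrightarrow> A x x = 0"
  unfolding alternating_form_def by blast+

text \<open>Apart from the term in which \<open>y\<close> or \<open>x\<close> itself is deleted,
  these are double contractions along \<open>A x\<close> and \<open>A y\<close>, to which
  \<open>contract_anticommute\<close> and \<open>contract_contract_same\<close> apply.\<close>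

lemma contract_pf_word_Cons:
  assumes "alternating_form A"
  shows "contract (A x) (pf_word A m) (y # v) = - contract (A y) (pf_word A m) (x # v)"
    and "contract (A x) (pf_word A m) (x # v) = 0"
proof -
  note A = alternating_form_swap[OF assms, of x y] alternating_form_same[OF assms]
  have "contract (A x) (\<lambda>u. pf_word A m (y # u)) v = - contract (A y) (\<lambda>u. pf_word A m (x # u)) v"
    \<comment> \<open>For \<open>m = 0\<close> the contracted function is zero, as
      \<open>pf_word A 0\<close> vanishes on nonempty words.\<close>
    by (cases m) (simp_all add: contract_zero contract_anticommute[of "A x" "A y"])
  then show "contract (A x) (pf_word A m) (y # v) = - contract (A y) (pf_word A m) (x # v)"
    using A by simp
  have "contract (A x) (\<lambda>u. pf_word A m (x # u)) v = 0"
    by (cases m) (simp_all add: contract_zero contract_contract_same)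
  then show "contract (A x) (pf_word A m) (x # v) = 0" using A by simp
qed

text \<open>The recursion singles out the first letter. Neighbours further right are handled by
  \<open>alternating_contract\<close>, the first two letters by
  \<open>contract_pf_word_Cons\<close>.\<close>

lemma alternating_pf_word:
  assumes "alternating_form A"
  shows "alternating (pf_word A m)"
proof (induction m)
  case 0
  show ?case by (simp add: alternating_def)
next
  case (Suc m)
  note alt = alternating_contract[OF Suc]
  have "pf_word A (Suc m) (u @ x # y # v) = - pf_word A (Suc m) (u @ y # x # v)" for u x y v
  proof (cases u)
    case Nil
    then show ?thesis using contract_pf_word_Cons(1)[OF assms, of x m y v] by simp
  next
    case (Cons z u')
    then show ?thesis using alternating_swap[OF alt, of _ u' x y v] by simp
  qed
  moreover have "pf_word A (Suc m) (u @ x # x # v) = 0" for u x v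
  proof (cases u)
    case Nil
    then show ?thesis using contract_pf_word_Cons(2)[OF assms, of x m v] by simp
  next
    case (Cons z u')
    then show ?thesis using alternating_same[OF alt, of _ u' x v] by simp
  qed
  ultimately show ?case unfolding alternating_def by blast
qed

text \<open>\<open>pf_word A (Suc k) (y # b)\<close> is itself a contraction along
  \<open>A y\<close>, so \<open>contract_interchange\<close> applies; the minus sign is that of
  \<open>A y z = - A z y\<close>.\<close>

lemma pf_word_pluecker:
  assumes "alternating_form A"
  shows "contract (\<lambda>y. pf_word A (Suc k) (y # b)) (pf_word A m) a =
    - contract (\<lambda>z. pf_word A (Suc m) (z # a)) (pf_word A k) b"
proof -
  have A: "(\<lambda>y. A y z) = (\<lambda>y. - A z y)" for z
    using alternating_form_swap[OF assms] by blast
  show ?thesis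
    using contract_interchange[of A "pf_word A k" b "pf_word A m" a]
    unfolding A contract_uminus_fun by simp
qed

text \<open>In a strictly increasing word the position of a letter is the number of smaller
  letters.\<close>

lemma contract_sorted:
  fixes w :: "'b::linorder list"
  assumes "sorted_wrt (<) w"
  shows "contract f G w = (\<Sum>x\<in>set w. (- 1) ^ card {y \<in> set w. y < x} * f x * G (remove1 x w))"
  using assms
proof (induction w arbitrary: G)
  case (Cons z w)
  have z: "z \<notin> set w" and lt: "\<And>y. y \<in> set w \<Longrightarrow> z < y" using Cons.prems by auto
  define t where "t x = (- 1) ^ card {y \<in> set (z # w). y < x} * f x * G (remove1 x (z # w))" for x
  have "{y \<in> set (z # w). y < z} = {}" using lt by force
  then have tz: "t z = f z * G w" unfolding t_def by (simp only: card.empty) simp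
  \<comment> \<open>The new smaller letter \<open>z\<close> raises every rank by one, which is the
    sign in the recursion.\<close>
  have tw: "t x = - ((- 1) ^ card {y \<in> set w. y < x} * f x * G (z # remove1 x w))"
    if "x \<in> set w" for x
  proof -
    have "{y \<in> set (z # w). y < x} = insert z {y \<in> set w. y < x}" using lt[OF that] by auto
    then have "card {y \<in> set (z # w). y < x} = Suc (card {y \<in> set w. y < x})" using z by simp
    moreover have "z \<noteq> x" using that z by blast
    ultimately show ?thesis by (simp add: t_def)
  qed
  have "contract f G (z # w) = t z + (\<Sum>x\<in>set w. t x)"
    using Cons.IH[of "\<lambda>u. G (z # u)"] Cons.prems by (simp add: tz tw sum_negf)
  also have "\<dots> = (\<Sum>x\<in>set (z # w). t x)" using z by simp
  finally show ?case unfolding t_def .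
qed simp

section \<open>Expansion of the Pfaffian along the first row\<close>

text \<open>\<open>skip j\<close> enumerates the indices other than \<open>0\<close> and \<open>Suc j\<close> in increasing order.\<close>

definition skip :: "nat \<Rightarrow> nat \<Rightarrow> nat" where
  "skip j a = Suc (insert_index j a)"

lemma inj_skip: "inj (skip j)"
  using inj_compose[OF inj_Suc insert_index_inj_on[of j]] by (simp add: skip_def[abs_def] comp_def)

lemma skip_less: "a < n \<Longrightarrow> skip j a < Suc (Suc n)"
  by (auto simp: skip_def insert_index_def)

lemma skip_mono: "a < b \<Longrightarrow> skip j a < skip j b"
  by (auto simp: skip_def insert_index_def)

lemma skip_image:
  assumes "j < Suc n"
  shows "skip j ` {..<n} = {..<Suc (Suc n)} - {0, Suc j}"
proof -
  have "skip j ` {..<n} = Suc ` (insert_index j ` {0..<n})"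
    by (auto simp: skip_def lessThan_atLeast0)
  also have "\<dots> = Suc ` ({0..<Suc n} - {j})" by (simp only: insert_index_image[OF assms])
  also have "\<dots> = {..<Suc (Suc n)} - {0, Suc j}"
    by (subst image_set_diff) auto
  finally show ?thesis .
qed

section \<open>Matchings classified by the partner of the first index\<close>

definition match_first :: "nat \<Rightarrow> nat set set \<Rightarrow> nat set set" where
  "match_first j M = insert {0, Suc j} ((`) (skip j) ` M)"

lemma zero_notin_skip: "C \<in> (`) (skip j) ` M \<Longrightarrow> 0 \<notin> C"
  by (auto simp: skip_def)

lemma partition_on_skip:
  assumes "j < Suc n"
  shows "partition_on ({..<Suc (Suc n)} - {0, Suc j}) ((`) (skip j) ` M) \<longleftrightarrow> partition_on {..<n} M"
proof -
  have "\<Union> ((`) (skip j) ` M) = skip j ` \<Union> M" by blast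
  moreover have "skip j ` \<Union> M = skip j ` {..<n} \<longleftrightarrow> \<Union> M = {..<n}"
    by (rule inj_image_eq_iff[OF inj_skip])
  moreover have "disjoint ((`) (skip j) ` M) \<longleftrightarrow> disjoint M"
  proof -
    have "skip j ` C \<inter> skip j ` D = skip j ` (C \<inter> D)" for C D
      by (simp add: image_Int[OF inj_skip])
    then show ?thesis
      by (simp add: disjoint_def pairwise_image pairwise_def disjnt_def inj_image_eq_iff[OF inj_skip])
  qed
  moreover have "{} \<in> (`) (skip j) ` M \<longleftrightarrow> {} \<in> M" by auto
  ultimately show ?thesis unfolding partition_on_def skip_image[OF assms, symmetric] by simp
qed

lemma match_first_in_matchings:
  assumes "j < Suc n"
  shows "match_first j M \<in> matchings (Suc (Suc n)) \<longleftrightarrow> M \<in> matchings n"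
proof -
  define P where "P = (`) (skip j) ` M"
  have nz: "0 \<notin> D" if "D \<in> P" for D using zero_notin_skip that unfolding P_def .
  have P: "partition_on ({..<Suc (Suc n)} - {0, Suc j}) P \<longleftrightarrow> partition_on {..<n} M"
    unfolding P_def by (rule partition_on_skip[OF assms])
  have card: "card (skip j ` C) = card C" for C
    by (rule card_image) (rule inj_on_subset[OF inj_skip], simp)
  \<comment> \<open>\<open>partition_on_insert\<close> presupposes this disjointness, so it is
    derived from either side of the equivalence.\<close>
  have dis: "disjnt {0, Suc j} (\<Union> P)"
    if "partition_on {..<Suc (Suc n)} (insert {0, Suc j} P) \<or>
      partition_on ({..<Suc (Suc n)} - {0, Suc j}) P"
    using that
  proof
    assume "partition_on {..<Suc (Suc n)} (insert {0, Suc j} P)"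
    then have dj: "disjoint (insert {0, Suc j} P)" by (rule partition_onD2)
    have "{0, Suc j} \<inter> D = {}" if "D \<in> P" for D
      by (rule disjointD[OF dj]) (use that nz[OF that] in auto)
    then show ?thesis by (simp add: disjnt_def)
  next
    assume "partition_on ({..<Suc (Suc n)} - {0, Suc j}) P"
    then have "\<Union> P = {..<Suc (Suc n)} - {0, Suc j}" by (simp add: partition_on_def)
    then show ?thesis by (simp only: disjnt_def Diff_disjoint)
  qed
  have sub: "{0, Suc j} \<subseteq> {..<Suc (Suc n)} \<and> {0, Suc j} \<noteq> {}" using assms by simp
  have "partition_on {..<Suc (Suc n)} (insert {0, Suc j} P) \<longleftrightarrow> partition_on {..<n} M"
  proof
    assume L: "partition_on {..<Suc (Suc n)} (insert {0, Suc j} P)"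
    from L[unfolded partition_on_insert[OF dis[OF disjI1[OF L]]]]
    show "partition_on {..<n} M" unfolding P by (rule conjunct1)
  next
    assume "partition_on {..<n} M"
    then have R: "partition_on ({..<Suc (Suc n)} - {0, Suc j}) P" unfolding P .
    show "partition_on {..<Suc (Suc n)} (insert {0, Suc j} P)"
      unfolding partition_on_insert[OF dis[OF disjI2[OF R]]] using R sub by (rule conjI)
  qed
  moreover have "(\<forall>B\<in>insert {0, Suc j} P. card B = 2) \<longleftrightarrow> (\<forall>B\<in>M. card B = 2)"
    by (simp add: P_def card)
  ultimately show ?thesis unfolding matchings_def match_first_def P_def[symmetric] mem_Collect_eq
    by (rule arg_cong2)
qed

text \<open>The block of 0 determines \<open>j\<close>; the other blocks avoid 0 and
  \<open>Suc j\<close>, so they lie in the range of \<open>skip j\<close> and can be pulled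
  back.\<close>

lemma matchings_cases:
  assumes N: "N \<in> matchings (Suc (Suc n))"
  obtains j M where "j < Suc n" "M \<in> matchings n" "N = match_first j M"
proof -
  have part: "partition_on {..<Suc (Suc n)} N" and c2: "\<And>B. B \<in> N \<Longrightarrow> card B = 2"
    using N by (auto simp: matchings_def)
  have U: "\<Union> N = {..<Suc (Suc n)}" and dj: "disjoint N" using part by (auto simp: partition_on_def)
  have "0 \<in> \<Union> N" by (simp add: U)
  then obtain B where B: "B \<in> N" "0 \<in> B" by (rule UnionE)
  obtain j where j: "B = {0, Suc j}"
  proof -
    obtain a b where ab: "B = {a, b}" "a \<noteq> b" using c2[OF B(1)] by (auto simp: card_2_iff)
    \<comment> \<open>One of \<open>a\<close>, \<open>b\<close> is 0, so the sum is the other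
      one.\<close>
    then have "B = {0, a + b}" "a + b \<noteq> 0" using B(2) by auto
    then show thesis using that by (metis not0_implies_Suc)
  qed
  have "Suc j \<in> {..<Suc (Suc n)}" unfolding U[symmetric] using B(1) by (auto simp: j)
  then have jn: "j < Suc n" by simp
  define M where "M = {C. skip j ` C \<in> N - {B}}"
  have "(`) (skip j) ` M = N - {B}"
  proof
    show "(`) (skip j) ` M \<subseteq> N - {B}" by (auto simp: M_def)
    show "N - {B} \<subseteq> (`) (skip j) ` M"
    proof
      fix D assume D: "D \<in> N - {B}"
      have "B \<inter> D = {}" using disjointD[OF dj B(1)] D by blast
      moreover have "D \<subseteq> {..<Suc (Suc n)}" using D U by blast
      ultimately have "D \<subseteq> {..<Suc (Suc n)} - {0, Suc j}" unfolding j by blast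
      then have "D \<subseteq> skip j ` {..<n}" by (simp only: skip_image[OF jn])
      then obtain C where "D = skip j ` C" by (rule subset_imageE)
      then show "D \<in> (`) (skip j) ` M" using D by (auto simp: M_def)
    qed
  qed
  then have N': "N = match_first j M" using B(1) by (simp add: match_first_def j insert_absorb)
  then have "M \<in> matchings n" using N match_first_in_matchings[OF jn] by simp
  then show ?thesis using that[OF jn _ N'] by simp
qed

lemma match_first_inj:
  assumes "match_first i M = match_first j N"
  shows "i = j \<and> M = N"
proof -
  have block: "C \<in> match_first i M \<and> 0 \<in> C \<longleftrightarrow> C = {0, Suc i}" for i M C
    using zero_notin_skip unfolding match_first_def by blast
  have rest: "(`) (skip i) ` M = {C \<in> match_first i M. 0 \<notin> C}" for i M
    using zero_notin_skip unfolding match_first_def by blast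
  have "{0, Suc i} = {0, Suc j}" using block[of _ i M] block[of _ j N] assms by metis
  then have "i = j" by (simp add: doubleton_eq_iff)
  moreover have "(`) (skip i) ` M = (`) (skip j) ` N" by (simp only: rest assms)
  ultimately show ?thesis
    by (metis inj_image_eq_iff inj_skip inj_def)
qed

text \<open>\<open>\<tau>\<close> lists the new block first, then \<open>\<sigma>\<close> carried
  along by \<open>skip j\<close>. The inner insertion contributes \<open>(- 1) ^ j\<close> to the
  sign, the outer one nothing.\<close>

lemma lists_match_first:
  assumes \<sigma>: "lists_matching n \<sigma> M" and n: "even n" and j: "j < Suc n"
  defines "\<tau> \<equiv> permutation_insert 0 0 (permutation_insert 0 j \<sigma>)"
  shows "lists_matching (Suc (Suc n)) \<tau> (match_first j M)"
    and "sign \<tau> = (- 1) ^ j * sign \<sigma>"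
    and "\<tau> 0 = 0" "\<tau> (Suc 0) = Suc j" "\<tau> (Suc (Suc k)) = skip j (\<sigma> k)"
proof -
  show t: "\<tau> 0 = 0" "\<tau> (Suc 0) = Suc j" "\<tau> (Suc (Suc k)) = skip j (\<sigma> k)" for k
    by (simp_all add: \<tau>_def permutation_insert_def insert_dom_def insert_ran_def skip_def)
  have s: "\<sigma> permutes {0..<n}" using \<sigma> by (simp add: lists_matching_def lessThan_atLeast0)
  have s': "permutation_insert 0 j \<sigma> permutes {0..<Suc n}"
    by (rule permutation_insert_permutes[OF s zero_less_Suc j])
  have tp: "\<tau> permutes {0..<Suc (Suc n)}"
    unfolding \<tau>_def by (rule permutation_insert_permutes[OF s' zero_less_Suc zero_less_Suc])
  have "signof \<tau> = ((- 1) ^ j * signof \<sigma> :: int)"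
    using signof_permutation_insert[OF s' zero_less_Suc zero_less_Suc, where 'a = int]
      signof_permutation_insert[OF s zero_less_Suc j, where 'a = int]
    by (simp add: \<tau>_def)
  then show "sign \<tau> = (- 1) ^ j * sign \<sigma>" by simp
  obtain h where h: "n = 2 * h" using n by auto
  have dv: "Suc (Suc n) div 2 = Suc h" "n div 2 = h" by (simp_all add: h)
  have st: "\<tau> (2 * k) < \<tau> (2 * k + 1)" if "k < Suc h" for k
  proof (cases k)
    case (Suc l)
    then show ?thesis using \<sigma> that by (simp add: t lists_matching_def dv skip_mono)
  qed (simp add: t)
  have "M = (\<lambda>k. {\<sigma> (2 * k), \<sigma> (2 * k + 1)}) ` {..<h}"
    using \<sigma> by (simp add: lists_matching_def dv)
  then have "match_first j M = (\<lambda>k. {\<tau> (2 * k), \<tau> (2 * k + 1)}) ` {..<Suc h}"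
    by (simp add: match_first_def lessThan_Suc_eq_insert_0 image_image t)
  then show "lists_matching (Suc (Suc n)) \<tau> (match_first j M)"
    using tp st by (simp add: lists_matching_def dv lessThan_atLeast0)
qed

text \<open>Lets an explicit listing replace the one picked by \<open>SOME\<close>.\<close>

lemma Pf_term_listing:
  assumes "dim_row A = n" "even n" "lists_matching n \<sigma> M"
  shows "pf_term A (SOME \<sigma>. lists_matching n \<sigma> M) = pf_term A \<sigma>"
proof (rule pf_term_unique)
  show "lists_matching (dim_row A) (SOME \<sigma>. lists_matching n \<sigma> M) M"
    unfolding assms(1) by (rule someI[of "\<lambda>\<sigma>. lists_matching n \<sigma> M", OF assms(3)])
qed (use assms in simp_all)

text \<open>\<open>match_first\<close> turns the sum over matchings into one over a partner of 0 and
  a matching of the rest; \<open>lists_match_first\<close> splits each term accordingly.\<close>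

lemma Pf_first_row:
  fixes f :: "nat \<Rightarrow> nat \<Rightarrow> 'a::comm_ring_1"
  assumes "even n"
  shows "Pf (mat (Suc (Suc n)) (Suc (Suc n)) (\<lambda>(a, b). f a b)) =
    (\<Sum>j<Suc n. (- 1) ^ j * f 0 (Suc j) * Pf (mat n n (\<lambda>(a, b). f (skip j a) (skip j b))))"
proof -
  obtain h where h: "n = 2 * h" using assms by auto
  let ?N = "Suc (Suc n)"
  let ?A = "mat ?N ?N (\<lambda>(a, b). f a b)"
  let ?B = "\<lambda>j. mat n n (\<lambda>(a, b). f (skip j a) (skip j b))"
  have bij: "bij_betw (\<lambda>(j, M). match_first j M) ({..<Suc n} \<times> matchings n) (matchings ?N)"
    unfolding bij_betw_def
  proof
    show "inj_on (\<lambda>(j, M). match_first j M) ({..<Suc n} \<times> matchings n)"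
      by (auto simp: inj_on_def dest: match_first_inj)
    show "(\<lambda>(j, M). match_first j M) ` ({..<Suc n} \<times> matchings n) = matchings ?N"
      using match_first_in_matchings by (fastforce elim: matchings_cases)
  qed
  have "Pf ?A = (\<Sum>N\<in>matchings ?N. pf_term ?A (SOME \<sigma>. lists_matching ?N \<sigma> N))"
    by (simp add: Pf_def)
  also have "\<dots> = (\<Sum>(j, M)\<in>{..<Suc n} \<times> matchings n.
      pf_term ?A (SOME \<sigma>. lists_matching ?N \<sigma> (match_first j M)))"
    by (subst sum.reindex_bij_betw[OF bij, symmetric]) (simp add: case_prod_unfold)
  also have "\<dots> = (\<Sum>(j, M)\<in>{..<Suc n} \<times> matchings n.
      (- 1) ^ j * f 0 (Suc j) * pf_term (?B j) (SOME \<sigma>. lists_matching n \<sigma> M))"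
  proof (rule sum.cong[OF refl], clarify)
    fix j M assume j: "j < Suc n" and M: "M \<in> matchings n"
    obtain \<sigma> where \<sigma>: "lists_matching n \<sigma> M" using lists_matching_exists[OF M] by blast
    define \<tau> where "\<tau> = permutation_insert 0 0 (permutation_insert 0 j \<sigma>)"
    note t = lists_match_first[OF \<sigma> assms j, folded \<tau>_def]
    have sl: "\<sigma> k < n" if "k < n" for k
      using \<sigma> that permutes_in_image[of \<sigma> "{..<n}" k] by (simp add: lists_matching_def)
    have "pf_term ?A (SOME \<sigma>. lists_matching ?N \<sigma> (match_first j M)) = pf_term ?A \<tau>"
      using assms t(1) by (intro Pf_term_listing) simp_all
    also have "\<dots> = of_int (sign \<tau>) * (\<Prod>k<Suc h. ?A $$ (\<tau> (2 * k), \<tau> (2 * k + 1)))"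
      by (simp add: pf_term_def h)
    also have "(\<Prod>k<Suc h. ?A $$ (\<tau> (2 * k), \<tau> (2 * k + 1))) =
        f 0 (Suc j) * (\<Prod>k<h. ?B j $$ (\<sigma> (2 * k), \<sigma> (2 * k + 1)))"
    proof -
      have "?A $$ (skip j (\<sigma> (2 * k)), skip j (\<sigma> (Suc (2 * k)))) =
          ?B j $$ (\<sigma> (2 * k), \<sigma> (2 * k + 1))" if "k < h" for k
        using that sl[of "2 * k"] sl[of "2 * k + 1"] by (simp add: skip_less h)
      then have "(\<Prod>k<h. ?A $$ (skip j (\<sigma> (2 * k)), skip j (\<sigma> (Suc (2 * k))))) =
          (\<Prod>k<h. ?B j $$ (\<sigma> (2 * k), \<sigma> (2 * k + 1)))"
        by (intro prod.cong) simp_all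
      then show ?thesis
        unfolding prod.lessThan_Suc_shift using j by (simp add: t)
    qed
    also have "of_int (sign \<tau>) * \<dots> = (- 1) ^ j * f 0 (Suc j) * pf_term (?B j) \<sigma>"
      by (simp add: pf_term_def t h mult_ac)
    also have "pf_term (?B j) \<sigma> = pf_term (?B j) (SOME \<sigma>. lists_matching n \<sigma> M)"
      using assms \<sigma> by (intro Pf_term_listing[symmetric]) simp_all
    finally show "pf_term ?A (SOME \<sigma>. lists_matching ?N \<sigma> (match_first j M)) =
        (- 1) ^ j * f 0 (Suc j) * pf_term (?B j) (SOME \<sigma>. lists_matching n \<sigma> M)" .
  qed
  also have "\<dots> = (\<Sum>j<Suc n. (- 1) ^ j * f 0 (Suc j) * Pf (?B j))"
    by (simp only: Pf_def dim_row_mat sum_distrib_left sum.cartesian_product)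
  finally show ?thesis .
qed

section \<open>Pluecker relations for principal minors\<close>

lemma Pf_dim_zero:
  assumes "dim_row A = 0"
  shows "Pf A = 1"
proof -
  have "matchings 0 = {{}}" by (auto simp: matchings_def partition_on_empty)
  moreover have "pf_term A (SOME \<sigma>. lists_matching 0 \<sigma> {}) = pf_term A id"
    using assms by (intro Pf_term_listing) (simp_all add: lists_matching_def permutes_id)
  ultimately show ?thesis using assms by (simp add: Pf_def pf_term_def)
qed

text \<open>Both sides obey the same expansion: for \<open>w = x # u\<close>, the positions
  \<open>skip j\<close> of \<open>w\<close> spell \<open>u\<close> without its letter at
  \<open>j\<close>.\<close>

lemma Pf_mat_word:
  assumes "length w = 2 * m"
  shows "Pf (mat (2 * m) (2 * m) (\<lambda>(a, b). K (w ! a) (w ! b))) = pf_word K m w"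
  using assms
proof (induction m arbitrary: w)
  case 0
  then show ?case by (simp add: Pf_dim_zero)
next
  case (Suc m)
  then obtain x u where w: "w = x # u" and u: "length u = Suc (2 * m)"
    by (cases w) auto
  define del where "del j = take j u @ drop (Suc j) u" for j
  have minor: "Pf (mat (2 * m) (2 * m) (\<lambda>(a, b). K (w ! skip j a) (w ! skip j b))) =
      pf_word K m (del j)" if "j < Suc (2 * m)" for j
  proof -
    have "w ! skip j a = del j ! a" if "a < 2 * m" for a
      using that \<open>j < Suc (2 * m)\<close> u
      by (simp add: w del_def skip_def insert_index_def nth_append min_def)
    then have "mat (2 * m) (2 * m) (\<lambda>(a, b). K (w ! skip j a) (w ! skip j b)) =
        mat (2 * m) (2 * m) (\<lambda>(a, b). K (del j ! a) (del j ! b))"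
      by (intro eq_matI) auto
    moreover have "length (del j) = 2 * m" using that u by (simp add: del_def)
    ultimately show ?thesis using Suc.IH by simp
  qed
  have "Pf (mat (2 * Suc m) (2 * Suc m) (\<lambda>(a, b). K (w ! a) (w ! b))) =
      (\<Sum>j<Suc (2 * m). (- 1) ^ j * K x (u ! j) * pf_word K m (del j))"
    using Pf_first_row[of "2 * m" "\<lambda>a b. K (w ! a) (w ! b)"] minor
    by (simp add: w del: sum.lessThan_Suc)
  also have "\<dots> = pf_word K (Suc m) w"
    by (simp add: w u contract_nth del_def del: sum.lessThan_Suc)
  finally show ?case .
qed

text \<open>Extended by 0 outside the matrix, so that \<open>alternating_form\<close>, which ranges
  over all naturals, can hold.\<close>

definition entry :: "'a::comm_ring_1 mat \<Rightarrow> nat \<Rightarrow> nat \<Rightarrow> 'a" where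
  "entry A i j = (if i < dim_row A \<and> j < dim_row A then A $$ (i, j) else 0)"

lemma alternating_form_entry:
  assumes "skew_symmetric A"
  shows "alternating_form (entry A)"
proof -
  have sq: "dim_col A = dim_row A" and tr: "transpose_mat A = - A"
    and dg: "\<And>i. i < dim_row A \<Longrightarrow> A $$ (i, i) = 0"
    using assms by (auto simp: skew_symmetric_def)
  have sk: "A $$ (i, j) = - A $$ (j, i)" if "i < dim_row A" "j < dim_row A" for i j
    using arg_cong[OF tr, of "\<lambda>M. M $$ (j, i)"] that sq by simp
  have "entry A i j = - entry A j i" for i j
  proof (cases "i < dim_row A \<and> j < dim_row A")
    case True
    then show ?thesis using sk[of i j] by (simp add: entry_def)
  qed (auto simp: entry_def)
  moreover have "entry A i i = 0" for i by (simp add: entry_def dg)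
  ultimately show ?thesis unfolding alternating_form_def by blast
qed

text \<open>Both enumerate \<open>I\<close> increasingly, and a strictly increasing list is
  determined by its set of elements.\<close>

lemma pick_eq_nth:
  assumes "finite I" "a < card I"
  shows "pick I a = sorted_list_of_set I ! a"
proof -
  let ?l = "map (pick I) [0..<card I]"
  have lt: "pick I a < pick I b" if "a < b" "b < card I" for a b
    using pick_mono_le that by blast
  have sorted: "sorted_wrt (<) ?l"
    by (auto simp: sorted_wrt_iff_nth_less lt)
  have "set ?l \<subseteq> I" using pick_in_set_le by auto
  moreover have "card (set ?l) = card I"
    using sorted by (simp add: distinct_card strict_sorted_iff del: set_map)
  ultimately have "set ?l = I" using assms(1) by (simp add: card_subset_eq)
  then have "sorted_list_of_set I = ?l"
    using sorted_list_of_set_unique[OF assms(1), of ?l] sorted by simp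
  then show ?thesis using assms(2) by simp
qed

text \<open>Intended for \<open>card S = 2 * m\<close>: the Pfaffian of the principal submatrix on
  \<open>S\<close>, with the original indices kept.\<close>

definition pf_set :: "(nat \<Rightarrow> nat \<Rightarrow> 'a::comm_ring_1) \<Rightarrow> nat \<Rightarrow> nat set \<Rightarrow> 'a" where
  "pf_set K m S = pf_word K m (sorted_list_of_set S)"

lemma Pf_submatrix:
  assumes "dim_col A = dim_row A" "I \<subseteq> {..<dim_row A}" "card I = 2 * r"
  shows "Pf (submatrix A I I) = pf_set (entry A) r I"
proof -
  have fin: "finite I" using assms(2) finite_subset by blast
  have I: "{i. i < dim_row A \<and> i \<in> I} = I" using assms(2) by auto
  let ?w = "sorted_list_of_set I"
  have "submatrix A I I = mat (2 * r) (2 * r) (\<lambda>(a, b). entry A (?w ! a) (?w ! b))"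
  proof (rule eq_matI)
    fix a b assume "a < dim_row (mat (2 * r) (2 * r) (\<lambda>(a, b). entry A (?w ! a) (?w ! b)))"
      "b < dim_col (mat (2 * r) (2 * r) (\<lambda>(a, b). entry A (?w ! a) (?w ! b)))"
    then have ab: "a < card I" "b < card I" using assms(3) by simp_all
    then have "?w ! a \<in> I" "?w ! b \<in> I"
      using fin by (metis length_sorted_list_of_set nth_mem set_sorted_list_of_set)+
    then show "submatrix A I I $$ (a, b) =
        mat (2 * r) (2 * r) (\<lambda>(a, b). entry A (?w ! a) (?w ! b)) $$ (a, b)"
      using ab assms fin by (auto simp: submatrix_def I pick_eq_nth entry_def)
  qed (simp_all add: dim_submatrix I assms)
  then show ?thesis using Pf_mat_word[of ?w r] assms(3) by (simp add: pf_set_def)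
qed

lemma Pf_eq_pf_set:
  assumes "A \<in> carrier_mat (2 * m) (2 * m)"
  shows "Pf A = pf_set (entry A) m {..<2 * m}"
proof -
  have "A = mat (2 * m) (2 * m) (\<lambda>(a, b). entry A ([0..<2 * m] ! a) ([0..<2 * m] ! b))"
    using assms by (intro eq_matI) (auto simp: entry_def)
  then have "Pf A = pf_word (entry A) m [0..<2 * m]"
    using Pf_mat_word[of "[0..<2 * m]" m "entry A"] by simp
  then show ?thesis by (simp add: pf_set_def lessThan_atLeast0)
qed

section \<open>The Pluecker relation for index sets\<close>

lemma contract_sorted_list_of_set:
  assumes "finite S"
  shows "contract f G (sorted_list_of_set S) =
    (\<Sum>x\<in>S. (- 1) ^ card {y \<in> S. y < x} * f x * G (sorted_list_of_set (S - {x})))"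
  using assms by (simp add: contract_sorted sorted_list_of_set_remove)

text \<open>Sorting \<open>y\<close> into place moves it past exactly the smaller elements of
  \<open>S\<close>.\<close>

lemma pf_word_Cons_notin:
  assumes K: "alternating_form K" and S: "finite S" "y \<notin> S"
  shows "pf_word K m (y # sorted_list_of_set S) =
    (- 1) ^ card {x \<in> S. x < y} * pf_set K m (insert y S)"
proof -
  let ?u = "sorted_list_of_set {x \<in> S. x < y}" and ?v = "sorted_list_of_set {x \<in> S. y < x}"
  have fin: "finite {x \<in> S. x < y}" "finite {x \<in> S. y < x}" using S(1) by simp_all
  have un: "S = {x \<in> S. x < y} \<union> {x \<in> S. y < x}" using S(2) by (auto simp: not_less_iff_gr_or_eq)
  have "card S = card {x \<in> S. x < y} + card {x \<in> S. y < x}"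
    by (subst un, rule card_Un_disjoint[OF fin]) auto
  then have "sorted_list_of_set S = ?u @ ?v"
    using S fin un sorted_list_of_set_unique[OF S(1), of "?u @ ?v"]
    by (auto simp: sorted_wrt_append)
  moreover have "sorted_list_of_set (insert y S) = ?u @ y # ?v"
    using S fin un \<open>card S = _\<close> sorted_list_of_set_unique[of "insert y S" "?u @ y # ?v"]
    by (auto simp: sorted_wrt_append)
  ultimately show ?thesis
    using alternating_move[OF alternating_pf_word[OF K], of m y ?u ?v] by (simp add: pf_set_def)
qed

lemma minus_one_power_cong: "even (a + b) \<Longrightarrow> (- 1) ^ a = ((- 1) ^ b :: 'a::ring_1)"
  by (auto simp: minus_one_power_iff)

text \<open>This is \<open>pf_word_pluecker\<close> for the increasing words of \<open>S\<close> and
  \<open>T\<close>. A term vanishes when its moved letter already occurs in the other word, so only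
  \<open>I - {i}\<close> survives on one side and only \<open>i\<close> on the other.\<close>

lemma pf_set_pluecker:
  fixes K :: "nat \<Rightarrow> nat \<Rightarrow> 'a::comm_ring_1"
  assumes K: "alternating_form K" and I: "I \<subseteq> {..<n}" and i: "i \<in> I"
    and min: "\<And>x. x \<in> I \<Longrightarrow> i \<le> x"
  shows "(\<Sum>x\<in>I - {i}. (- 1) ^ card {y \<in> I - {i}. y < x} *
      pf_set K m ({..<n} - {i, x}) * pf_set K (Suc k) ({..<n} - (I - {i} - {x}))) =
    pf_set K (Suc m) {..<n} * pf_set K k ({..<n} - I)"
proof -
  define S where "S = {..<n} - {i}"
  define T where "T = {..<n} - (I - {i})"
  have fin: "finite S" "finite T" by (simp_all add: S_def T_def)
  note alt = alternating_pf_word[OF K]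
  have zero: "pf_word K l (x # sorted_list_of_set U) = 0" if "finite U" "x \<in> U" for l x U
    using alternating_repeat[OF alt] that by simp
  have "(\<Sum>x\<in>S. (- 1) ^ card {y \<in> S. y < x} * pf_word K (Suc k) (x # sorted_list_of_set T) *
      pf_set K m (S - {x})) =
    - (\<Sum>z\<in>T. (- 1) ^ card {y \<in> T. y < z} * pf_word K (Suc m) (z # sorted_list_of_set S) *
      pf_set K k (T - {z}))"
    using pf_word_pluecker[OF K, of k "sorted_list_of_set T" m "sorted_list_of_set S"]
    unfolding contract_sorted_list_of_set[OF fin(1)] contract_sorted_list_of_set[OF fin(2)]
      pf_set_def .
  also have "(\<Sum>z\<in>T. (- 1) ^ card {y \<in> T. y < z} * pf_word K (Suc m) (z # sorted_list_of_set S) *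
      pf_set K k (T - {z})) =
    (\<Sum>z\<in>{i}. (- 1) ^ card {y \<in> T. y < z} * pf_word K (Suc m) (z # sorted_list_of_set S) *
      pf_set K k (T - {z}))"
  proof (rule sum.mono_neutral_right)
    show "{i} \<subseteq> T" using i I by (auto simp: T_def)
    have "T - {i} \<subseteq> S" by (auto simp: S_def T_def)
    then show "\<forall>z\<in>T - {i}. (- 1) ^ card {y \<in> T. y < z} *
        pf_word K (Suc m) (z # sorted_list_of_set S) * pf_set K k (T - {z}) = 0"
      using zero[OF fin(1)] by (simp add: subset_iff del: pf_word.simps)
  qed (rule fin)
  also have "\<dots> = pf_set K (Suc m) {..<n} * pf_set K k ({..<n} - I)"
  proof -
    have "i < n" using i I by auto
    \<comment> \<open>As \<open>i\<close> is least in \<open>I\<close>, both \<open>S\<close> and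
      \<open>T\<close> contain all of \<open>{..<i}\<close>, so the two signs cancel.\<close>
    then have "{y \<in> T. y < i} = {..<i}" "{y \<in> S. y < i} = {..<i}"
      using min by (auto simp: S_def T_def dest: leD)
    moreover have "insert i S = {..<n}" "i \<notin> S" "T - {i} = {..<n} - I"
      using \<open>i < n\<close> i by (auto simp: S_def T_def)
    ultimately show ?thesis
      using pf_word_Cons_notin[OF K fin(1) \<open>i \<notin> S\<close>, of "Suc m"]
      by (simp add: power_add[symmetric] mult.assoc[symmetric] del: pf_word.simps)
  qed
  also have "(\<Sum>x\<in>S. (- 1) ^ card {y \<in> S. y < x} * pf_word K (Suc k) (x # sorted_list_of_set T) *
      pf_set K m (S - {x})) =
    (\<Sum>x\<in>I - {i}. (- 1) ^ card {y \<in> S. y < x} * pf_word K (Suc k) (x # sorted_list_of_set T) *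
      pf_set K m (S - {x}))"
  proof (rule sum.mono_neutral_right)
    show "I - {i} \<subseteq> S" using I by (auto simp: S_def)
    have "S - (I - {i}) \<subseteq> T" by (auto simp: S_def T_def)
    then show "\<forall>x\<in>S - (I - {i}). (- 1) ^ card {y \<in> S. y < x} *
        pf_word K (Suc k) (x # sorted_list_of_set T) * pf_set K m (S - {x}) = 0"
      using zero[OF fin(2)] by (simp add: subset_iff del: pf_word.simps)
  qed (rule fin)
  also have "\<dots> = (\<Sum>x\<in>I - {i}. - ((- 1) ^ card {y \<in> I - {i}. y < x} *
      pf_set K m ({..<n} - {i, x}) * pf_set K (Suc k) ({..<n} - (I - {i} - {x}))))"
  proof (rule sum.cong[OF refl])
    fix x assume x: "x \<in> I - {i}"
    then have ix: "i < x" "x < n" "x \<notin> T" using min[of x] I by (auto simp: T_def)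
    \<comment> \<open>Below \<open>x\<close>, \<open>S\<close> lacks only \<open>i\<close>, while
      \<open>T\<close> and \<open>I - {i}\<close> split \<open>{..<x}\<close>. The combined sign is
      thus minus that of the rank in \<open>I - {i}\<close>, and this minus cancels the one of the
      Pluecker relation.\<close>
    have "insert i {y \<in> S. y < x} = {..<x}" using ix by (auto simp: S_def)
    moreover have "card (insert i {y \<in> S. y < x}) = Suc (card {y \<in> S. y < x})"
      by (rule card_insert_disjoint) (simp_all add: S_def)
    ultimately have cS: "Suc (card {y \<in> S. y < x}) = x" by simp
    have "{y \<in> T. y < x} \<union> {y \<in> I - {i}. y < x} = {..<x}" using ix by (auto simp: T_def)
    moreover have "card ({y \<in> T. y < x} \<union> {y \<in> I - {i}. y < x}) =
        card {y \<in> T. y < x} + card {y \<in> I - {i}. y < x}"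
      by (rule card_Un_disjoint) (auto simp: T_def)
    ultimately have cT: "card {y \<in> T. y < x} + card {y \<in> I - {i}. y < x} = x" by simp
    have "card {y \<in> S. y < x} + card {y \<in> T. y < x} + Suc (card {y \<in> I - {i}. y < x}) = 2 * x"
      using cS cT by linarith
    then have "(- 1) ^ card {y \<in> S. y < x} * (- 1) ^ card {y \<in> T. y < x} =
        ((- 1) ^ Suc (card {y \<in> I - {i}. y < x}) :: 'a)"
      unfolding power_add[symmetric] by (intro minus_one_power_cong) (simp only: dvd_triv_left)
    moreover have "insert x T = {..<n} - (I - {i} - {x})" "S - {x} = {..<n} - {i, x}"
      using ix by (auto simp: S_def T_def)
    ultimately show "(- 1) ^ card {y \<in> S. y < x} * pf_word K (Suc k) (x # sorted_list_of_set T) *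
        pf_set K m (S - {x}) = - ((- 1) ^ card {y \<in> I - {i}. y < x} *
        pf_set K m ({..<n} - {i, x}) * pf_set K (Suc k) ({..<n} - (I - {i} - {x})))"
      unfolding pf_word_Cons_notin[OF K fin(2) ix(3)]
      by (simp add: mult.assoc[symmetric])
  qed
  finally show ?thesis by (simp add: sum_negf)
qed

section \<open>Minors of the copfaffian matrix\<close>

text \<open>The least element heads the sorted word, so the recursion of \<open>pf_word\<close>
  expands along row \<open>i\<close>.\<close>

lemma pf_set_Suc:
  assumes "finite I" "i \<in> I" "\<And>x. x \<in> I \<Longrightarrow> i \<le> x"
  shows "pf_set K (Suc m) I =
    (\<Sum>x\<in>I - {i}. (- 1) ^ card {y \<in> I - {i}. y < x} * K i x * pf_set K m (I - {i} - {x}))"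
proof -
  have "sorted_list_of_set I = i # sorted_list_of_set (I - {i})"
    using assms sorted_list_of_set_nonempty[of I] Min_eqI[of I i] by auto
  then show ?thesis
    using assms(1) by (simp add: pf_set_def contract_sorted_list_of_set)
qed

lemma pf_set_doubleton:
  assumes "a < b"
  shows "pf_set K (Suc 0) {a, b} = K a b"
proof -
  have "{a, b} - {a} = {b}" using assms by auto
  then show ?thesis using pf_set_Suc[of "{a, b}" a K 0] assms by (auto simp: pf_set_def)
qed

lemma sum_Suc_remove:
  assumes "finite I" "x \<in> I"
  shows "(\<Sum>i\<in>I. Suc i) = Suc x + (\<Sum>i\<in>I - {x}. Suc i)"
  using assms by (rule sum.remove)

lemma entry_copf_mat:
  assumes "A \<in> carrier_mat (2 * Suc m) (2 * Suc m)" "i < x" "x < 2 * Suc m"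
  shows "entry (copf_mat A) i x = (- 1) ^ (i + x + 1) * pf_set (entry A) m ({..<2 * Suc m} - {i, x})"
proof -
  have "card ({..<2 * Suc m} - {i, x}) = 2 * m"
    using assms(2,3) by (subst card_Diff_subset) auto
  then have "Pf (submatrix A ({..<2 * Suc m} - {i, x}) ({..<2 * Suc m} - {i, x})) =
      pf_set (entry A) m ({..<2 * Suc m} - {i, x})"
    using assms(1) by (intro Pf_submatrix) auto
  then show ?thesis using assms by (simp add: entry_def copf_mat_def copf_entry_def)
qed

text \<open>Two-element sets give the definition of the copfaffian matrix; in the induction step
  \<open>pf_set_pluecker\<close> collapses the row expansion and supplies one more factor
  \<open>Pf A\<close>. Adding \<open>Suc r\<close> in the sign exponent instead of subtracting it
  avoids truncation.\<close>

lemma pf_set_copf_mat: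
  fixes A :: "'a::comm_ring_1 mat"
  assumes A: "A \<in> carrier_mat (2 * m) (2 * m)" "skew_symmetric A"
    and "I \<subseteq> {..<2 * m}" "card I = 2 * Suc r"
  shows "pf_set (entry (copf_mat A)) (Suc r) I = (- 1) ^ ((\<Sum>i\<in>I. Suc i) + Suc r) *
    Pf A ^ r * pf_set (entry A) (m - Suc r) ({..<2 * m} - I)"
  using assms(3,4)
proof (induction r arbitrary: I)
  case 0
  obtain m' where m: "m = Suc m'"
    using 0 card_mono[of "{..<2 * m}" I] by (cases m) auto
  obtain a b where I: "I = {a, b}" and ab: "a < b"
    using 0(2) by (auto simp: card_2_iff) (metis insert_commute linorder_neqE_nat)
  have "b < 2 * Suc m'" using 0(1) by (simp add: I m)
  \<comment> \<open>Counting indices from 1 raises the exponent by 2.\<close>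
  have "(- 1) ^ (a + b + 1) = ((- 1) ^ ((\<Sum>i\<in>I. Suc i) + Suc 0) :: 'a)"
    by (rule minus_one_power_cong) (use ab in \<open>simp add: I\<close>)
  then show ?case
    using entry_copf_mat[OF A(1)[unfolded m] ab \<open>b < 2 * Suc m'\<close>]
    by (simp add: I m pf_set_doubleton[OF ab])
next
  case (Suc r)
  have fin: "finite I" using Suc.prems(1) finite_subset by blast
  have "2 * Suc (Suc r) \<le> 2 * m"
    using card_mono[OF finite_lessThan Suc.prems(1)] Suc.prems(2) by simp
  then have "m = Suc (Suc (r + (m - Suc (Suc r))))" by simp
  \<comment> \<open>\<open>k\<close> is half the size of the complement of \<open>I\<close>.\<close>
  then obtain k where k: "m = Suc (Suc (r + k))" ..
  define i where "i = Min I"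
  have "I \<noteq> {}" using Suc.prems(2) by auto
  then have i: "i \<in> I" and min: "\<And>x. x \<in> I \<Longrightarrow> i \<le> x"
    using fin by (simp_all add: i_def)
  let ?s = "(- 1) ^ ((\<Sum>i\<in>I. Suc i) + Suc (Suc r)) :: 'a"
  let ?c = "\<lambda>x. (- 1) ^ card {y \<in> I - {i}. y < x} :: 'a"
  have "pf_set (entry (copf_mat A)) (Suc (Suc r)) I =
      (\<Sum>x\<in>I - {i}. ?c x * entry (copf_mat A) i x * pf_set (entry (copf_mat A)) (Suc r) (I - {i} - {x}))"
    by (rule pf_set_Suc[OF fin i min])
  also have "\<dots> = (\<Sum>x\<in>I - {i}. ?s * Pf A ^ r * (?c x *
      pf_set (entry A) (Suc (r + k)) ({..<2 * m} - {i, x}) *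
      pf_set (entry A) (Suc k) ({..<2 * m} - (I - {i} - {x}))))"
  proof (rule sum.cong[OF refl])
    fix x assume x: "x \<in> I - {i}"
    then have ix: "i < x" "x < 2 * Suc (Suc (r + k))" using min[of x] Suc.prems(1) k by auto
    have "card (I - {i} - {x}) = 2 * Suc r" using x i fin Suc.prems(2) by simp
    moreover have "I - {i} - {x} \<subseteq> {..<2 * m}" using Suc.prems(1) by blast
    ultimately have IH: "pf_set (entry (copf_mat A)) (Suc r) (I - {i} - {x}) =
        (- 1) ^ ((\<Sum>i\<in>I - {i} - {x}. Suc i) + Suc r) * Pf A ^ r *
        pf_set (entry A) (Suc k) ({..<2 * m} - (I - {i} - {x}))"
      using Suc.IH[of "I - {i} - {x}"] by (simp add: k)
    have e: "entry (copf_mat A) i x =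
        (- 1) ^ (i + x + 1) * pf_set (entry A) (Suc (r + k)) ({..<2 * m} - {i, x})"
      using entry_copf_mat[OF A(1)[unfolded k] ix] by (simp only: k)
    have "(\<Sum>i\<in>I. Suc i) = Suc i + (Suc x + (\<Sum>i\<in>I - {i} - {x}. Suc i))"
      using sum_Suc_remove[OF fin i] sum_Suc_remove[OF _ x] fin by simp
    \<comment> \<open>The two signs depending on \<open>x\<close> therefore multiply to
      \<open>?s\<close>, which can leave the sum.\<close>
    then have "i + x + 1 + ((\<Sum>i\<in>I - {i} - {x}. Suc i) + Suc r) +
        ((\<Sum>i\<in>I. Suc i) + Suc (Suc r)) = 2 * ((\<Sum>i\<in>I. Suc i) + Suc r)"
      by simp
    then have sgn: "(- 1) ^ (i + x + 1) * (- 1) ^ ((\<Sum>i\<in>I - {i} - {x}. Suc i) + Suc r) = ?s"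
      unfolding power_add[symmetric] by (intro minus_one_power_cong) (simp only: dvd_triv_left)
    show "?c x * entry (copf_mat A) i x * pf_set (entry (copf_mat A)) (Suc r) (I - {i} - {x}) =
        ?s * Pf A ^ r * (?c x * pf_set (entry A) (Suc (r + k)) ({..<2 * m} - {i, x}) *
        pf_set (entry A) (Suc k) ({..<2 * m} - (I - {i} - {x})))"
      unfolding IH e sgn[symmetric] by (simp only: mult_ac)
  qed
  also have "\<dots> = ?s * Pf A ^ r *
      (pf_set (entry A) m {..<2 * m} * pf_set (entry A) k ({..<2 * m} - I))"
    unfolding sum_distrib_left[symmetric]
    using pf_set_pluecker[OF alternating_form_entry[OF A(2)] Suc.prems(1) i min]
    by (simp only: k)
  finally show ?case
    unfolding Pf_eq_pf_set[OF A(1), symmetric] by (simp add: k mult_ac)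
qed

section \<open>Negative exponents and the passage back to matrices\<close>

lemma unit_powi_minus_one:
  assumes "x dvd 1"
  shows "unit_powi x (- 1) * x = 1"
proof -
  obtain y where y: "x * y = 1" using assms by (metis dvdE)
  then show ?thesis by (simp add: unit_powi_def unit_inverse_eqI[OF y] mult.commute[of y])
qed

lemma card_le_sum_Suc: "card I \<le> (\<Sum>i\<in>I. Suc i)"
  using sum_mono[of I "\<lambda>_. 1" Suc] by simp

lemma Pf_submatrix_copf_mat:
  fixes A :: "'a::comm_ring_1 mat"
  assumes A: "A \<in> carrier_mat (2 * m) (2 * m)" "skew_symmetric A"
    and I: "I \<subseteq> {..<2 * m}" "card I = 2 * r" and unit: "r = 0 \<Longrightarrow> Pf A dvd 1"
  shows "Pf (submatrix (copf_mat A) I I) =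
    (- 1) ^ ((\<Sum>i\<in>I. Suc i) - r) * unit_powi (Pf A) (int r - 1) *
    Pf (submatrix A ({..<2 * m} - I) ({..<2 * m} - I))"
proof -
  have fin: "finite I" using I(1) finite_subset by blast
  have "card ({..<2 * m} - I) = 2 * (m - r)"
    using I fin by (simp add: card_Diff_subset)
  then have co: "Pf (submatrix A ({..<2 * m} - I) ({..<2 * m} - I)) =
      pf_set (entry A) (m - r) ({..<2 * m} - I)"
    using A(1) by (intro Pf_submatrix) auto
  show ?thesis
  proof (cases r)
    case 0
    \<comment> \<open>The left side is the empty Pfaffian 1; on the right the complement is the
      whole index set, and the inverse cancels \<open>Pf A\<close>.\<close>
    then have "I = {}" using I(2) fin by simp
    moreover have "Pf (submatrix (copf_mat A) {} {}) = 1"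
      by (rule Pf_dim_zero) (simp add: dim_submatrix)
    ultimately show ?thesis
      using co unit_powi_minus_one[OF unit[OF 0]] Pf_eq_pf_set[OF A(1)] by (simp add: 0)
  next
    case (Suc q)
    have "Pf (submatrix (copf_mat A) I I) = pf_set (entry (copf_mat A)) r I"
      by (rule Pf_submatrix) (use A I in \<open>auto simp: copf_mat_def\<close>)
    also have "\<dots> = (- 1) ^ ((\<Sum>i\<in>I. Suc i) + r) * Pf A ^ q *
        pf_set (entry A) (m - r) ({..<2 * m} - I)"
      using pf_set_copf_mat[OF A I(1)] I(2) by (simp add: Suc)
    finally have P: "Pf (submatrix (copf_mat A) I I) = (- 1) ^ ((\<Sum>i\<in>I. Suc i) + r) * Pf A ^ q *
        pf_set (entry A) (m - r) ({..<2 * m} - I)" .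
    \<comment> \<open>Since \<open>r\<close> is at most the sum, the difference is exact, and adding
      or subtracting \<open>r\<close> gives the same parity.\<close>
    have "(\<Sum>i\<in>I. Suc i) + r + ((\<Sum>i\<in>I. Suc i) - r) = 2 * (\<Sum>i\<in>I. Suc i)"
      using card_le_sum_Suc[of I] I(2) by linarith
    then have "(- 1) ^ ((\<Sum>i\<in>I. Suc i) + r) = ((- 1) ^ ((\<Sum>i\<in>I. Suc i) - r) :: 'a)"
      by (intro minus_one_power_cong) (simp only: dvd_triv_left)
    then show ?thesis unfolding P co by (simp add: unit_powi_def Suc)
  qed
qed

text \<open>The minor formula for the complement of \<open>{i, j}\<close>: there
  \<open>r = m - 1\<close>, and the remaining Pfaffian is the single entry
  \<open>A $$ (i, j)\<close>. The case \<open>r = 0\<close> is \<open>m = 1\<close>.\<close>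

lemma copf_entry_copf_mat:
  fixes A :: "'a::comm_ring_1 mat"
  assumes A: "A \<in> carrier_mat (2 * m) (2 * m)" "skew_symmetric A"
    and ij: "i < j" "j < 2 * m" and unit: "m = 1 \<Longrightarrow> Pf A dvd 1"
  shows "copf_entry (copf_mat A) i j = unit_powi (Pf A) (int m - 2) * A $$ (i, j)"
proof -
  define I where "I = {..<2 * m} - {i, j}"
  obtain r where m: "m = Suc r" using ij by (cases m) auto
  have I: "I \<subseteq> {..<2 * m}" "card I = 2 * r" "{..<2 * m} - I = {i, j}"
    using ij m by (auto simp: I_def card_Diff_subset)
  have two: "Pf (submatrix A {i, j} {i, j}) = A $$ (i, j)"
    using Pf_submatrix[of A "{i, j}" 1] pf_set_doubleton[OF ij(1), of "entry A"] A(1) ij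
    by (simp add: entry_def)
  have P: "Pf (submatrix (copf_mat A) I I) =
      (- 1) ^ ((\<Sum>i\<in>I. Suc i) - r) * unit_powi (Pf A) (int m - 2) * A $$ (i, j)"
    using Pf_submatrix_copf_mat[OF A I(1,2), unfolded I(3) two] unit by (simp add: m)
  have "(\<Sum>x\<in>I. Suc x) + Suc i + Suc j = (\<Sum>x<2 * m. Suc x)"
    using sum_Suc_remove[of "{..<2 * m}" i] sum_Suc_remove[of "{..<2 * m} - {i}" j] ij
    by (simp add: I_def Diff_insert2[symmetric])
  \<comment> \<open>This fixes the parity of the index sum over \<open>I\<close>, whence the two
    signs multiply to 1.\<close>
  moreover have "(\<Sum>x<2 * m. Suc x) = m * (2 * m + 1)"
    by (induction m) (simp_all add: algebra_simps)
  ultimately have "(\<Sum>x\<in>I. Suc x) + (i + j + 2) = m + 2 * (m * m)" by (simp add: algebra_simps)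
  moreover have "r \<le> (\<Sum>x\<in>I. Suc x)" using card_le_sum_Suc[of I] I(2) by simp
  ultimately have "Suc i + Suc j - 1 + ((\<Sum>x\<in>I. Suc x) - r) = 2 * (m * m)" using m by linarith
  then have "even (Suc i + Suc j - 1 + ((\<Sum>x\<in>I. Suc x) - r))" by (simp only: dvd_triv_left)
  then have "(- 1) ^ (Suc i + Suc j - 1) * (- 1) ^ ((\<Sum>x\<in>I. Suc x) - r) = (1 :: 'a)"
    by (simp only: power_add[symmetric] power_minus_even power_one)
  moreover have "copf_entry (copf_mat A) i j =
      (- 1) ^ (Suc i + Suc j - 1) * Pf (submatrix (copf_mat A) I I)"
    using A(1) by (simp add: copf_entry_def copf_mat_def I_def)
  ultimately show ?thesis unfolding P by (simp only: mult.assoc[symmetric] mult_1)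
qed

theorem theorem2p6:
  fixes A :: "'a::comm_ring_1 mat" and m :: nat
  assumes "m \<ge> 1"
    and "A \<in> carrier_mat (2 * m) (2 * m)"
    and "skew_symmetric A"
  shows "(\<forall>I r. I \<subseteq> {..<2 * m} \<longrightarrow> card I = 2 * r \<longrightarrow> (r = 0 \<longrightarrow> Pf A dvd 1) \<longrightarrow>
            Pf (submatrix (copf_mat A) I I) =
              (- 1) ^ ((\<Sum>i\<in>I. Suc i) - r) * unit_powi (Pf A) (int r - 1) *
              Pf (submatrix A ({..<2 * m} - I) ({..<2 * m} - I)))
       \<and> ((m = 1 \<longrightarrow> Pf A dvd 1) \<longrightarrow>
            copf_mat (copf_mat A) = unit_powi (Pf A) (int m - 2) \<cdot>\<^sub>m A)"
proof (intro conjI allI impI)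
  fix I r
  assume "I \<subseteq> {..<2 * m}" "card I = 2 * r" "r = 0 \<longrightarrow> Pf A dvd 1"
  then show "Pf (submatrix (copf_mat A) I I) =
      (- 1) ^ ((\<Sum>i\<in>I. Suc i) - r) * unit_powi (Pf A) (int r - 1) *
      Pf (submatrix A ({..<2 * m} - I) ({..<2 * m} - I))"
    using Pf_submatrix_copf_mat[OF assms(2,3)] by blast
next
  assume "m = 1 \<longrightarrow> Pf A dvd 1"
  then have entry: "copf_entry (copf_mat A) i j = unit_powi (Pf A) (int m - 2) * A $$ (i, j)"
    if "i < j" "j < 2 * m" for i j
    using copf_entry_copf_mat[OF assms(2,3) that] by blast
  show "copf_mat (copf_mat A) = unit_powi (Pf A) (int m - 2) \<cdot>\<^sub>m A"
  proof (rule eq_matI)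
    fix i j assume "i < dim_row (unit_powi (Pf A) (int m - 2) \<cdot>\<^sub>m A)"
      "j < dim_col (unit_powi (Pf A) (int m - 2) \<cdot>\<^sub>m A)"
    then have ij: "i < 2 * m" "j < 2 * m" using assms(2) by simp_all
    \<comment> \<open>\<open>copf_mat\<close> fills the lower triangle and the diagonal by
      skew-symmetry, so \<open>A\<close> is compared there through its own.\<close>
    have A: "A $$ (j, i) = - A $$ (i, j)" "A $$ (i, i) = 0"
      using alternating_form_swap[OF alternating_form_entry[OF assms(3)], of j i]
        alternating_form_same[OF alternating_form_entry[OF assms(3)], of i] assms(2) ij
      by (simp_all add: entry_def)
    have dim: "dim_row (copf_mat A) = 2 * m" using assms(2) by (simp add: copf_mat_def)
    consider "i < j" | "j < i" | "i = j" by linarith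
    then show "copf_mat (copf_mat A) $$ (i, j) = (unit_powi (Pf A) (int m - 2) \<cdot>\<^sub>m A) $$ (i, j)"
      using ij assms(2) entry A by cases (simp_all add: copf_mat_def[of "copf_mat A"] dim)
  qed (use assms(2) in \<open>simp_all add: copf_mat_def\<close>)
qed

end
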